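(* Let $C_1,\dots,C_6$ be six cyclically intersecting ("black") circles in the plane, $C_i\cap C_{i+1}=\{P_i,Q_i\}$ (indices modulo 6), in general position. Introduce three "grey" circles, passing through $$\{P_1,P_2,P_3\},\qquad \{P_3,P_4,P_5\},\qquad \{P_5,P_6,P_1\},$$ and three "dashed" circles, passing through $$\{Q_2,Q_3,Q_4\},\qquad \{Q_4,Q_5,Q_6\},\qquad \{Q_6,Q_1,Q_2\}.$$ Then the three grey circles are concurrent if and only if the three dashed circles are concurrent.
   Context: Circles are understood in the sense of Möbius geometry (a line being a circle of infinite radius). For each $i$ the labelling $P_i$ ("black" points) and $Q_i$ ("grey" points) of the two intersection points is arbitrary but fixed. Three circles are concurrent if they have a common point. General position: the twelve points $P_i,Q_i$ are pairwise distinct, the twelve circles are pairwise distinct, any two grey circles meet in a second point (besides the $P_j$ they share by construction) different from all the $P_i,Q_i$, and likewise for any two dashed circles. (The resulting 14 points and 12 circles have the combinatorics of the vertices and faces of a rhombic dodecahedron.) *)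

theory Defs
  imports "HOL-Analysis.Analysis"
begin

text \<open>
  The Moebius plane is the one-point extension of the Euclidean plane, modelled as
  \<^typ>\<open>complex option\<close>; \<^term>\<open>None\<close> is the point at infinity and lies on every line.
\<close>

type_synonym mpoint = "complex option"

definition mobius_circle :: "mpoint set \<Rightarrow> bool" where
  "mobius_circle K \<longleftrightarrow>
     (\<exists>c r. r > 0 \<and> K = Some ` sphere c r) \<or>
     (\<exists>a b. a \<noteq> b \<and> K = insert None (Some ` (affine hull {a, b})))"

definition concurrent :: "'a set \<Rightarrow> 'a set \<Rightarrow> 'a set \<Rightarrow> bool" where
  "concurrent A B C \<longleftrightarrow> (\<exists>X. X \<in> A \<and> X \<in> B \<and> X \<in> C)"

end

theory Submission imports Defs begin

text \<open>
  Four distinct points of the Moebius plane are concyclic iff their cross-ratio is real.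
  The twelve circles are the faces of a quadrangulated sphere, the rhombic dodecahedron,
  whose vertex graph is bipartite (vertices of degree four against vertices of degree three).
  Orient all faces consistently and take in each face the cross-ratio starting at a vertex of
  degree four: every edge then occurs once in a numerator and once, with opposite sign, in a
  denominator, so the product of the twelve cross-ratios is one. Hence eleven concyclic faces
  force the twelfth to be concyclic.
\<close>

text \<open>
  The determinant of the homogeneous coordinates \<open>(z, 1)\<close> of \<open>Some z\<close> and \<open>(1, 0)\<close> of \<open>None\<close>;
  it spares the cross-ratio a special treatment of the point at infinity.
\<close>

fun bracket :: "mpoint \<Rightarrow> mpoint \<Rightarrow> complex" where
  "bracket None None = 0"
| "bracket None (Some w) = 1"
| "bracket (Some z) None = -1"
| "bracket (Some z) (Some w) = z - w"

definition cross_ratio :: "mpoint \<Rightarrow> mpoint \<Rightarrow> mpoint \<Rightarrow> mpoint \<Rightarrow> complex" where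
  "cross_ratio a b c d = (bracket a b * bracket c d) / (bracket b c * bracket d a)"

lemma bracket_eq_0_iff [simp]: "bracket p q = 0 \<longleftrightarrow> p = q"
  by (cases p; cases q) auto

lemma bracket_commute: "bracket p q = - bracket q p"
  by (cases p; cases q) auto

section \<open>Concyclicity as reality of the cross-ratio\<close>

text \<open>In coordinates centred at \<open>o'\<close>, conjugation sends each point
  \<open>z\<close> of the circle to \<open>R / z\<close>. Equating the cross-ratio with its
  conjugate thus becomes an algebraic condition on \<open>d\<close>, namely the equation of the
  circle.\<close>

lemma cross_ratio_sphere_iff:
  fixes a b c o' :: complex and d :: mpoint
  assumes r: "r > 0" and a: "a \<in> sphere o' r" and b: "b \<in> sphere o' r" and c: "c \<in> sphere o' r"
    and ne: "a \<noteq> b" "b \<noteq> c" "a \<noteq> c" "d \<noteq> Some a"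
  shows "cross_ratio (Some a) (Some b) (Some c) d \<in> \<real> \<longleftrightarrow> d \<in> Some ` sphere o' r"
proof -
  define R where "R = complex_of_real (r\<^sup>2)"
  have R0: "R \<noteq> 0" using r by (simp add: R_def)
  have sph: "z \<in> sphere o' r \<longleftrightarrow> (z - o') * cnj (z - o') = R" for z
  proof -
    have "z \<in> sphere o' r \<longleftrightarrow> (cmod (z - o'))\<^sup>2 = r\<^sup>2"
      using r by (simp add: dist_norm norm_minus_commute)
    also have "\<dots> \<longleftrightarrow> (z - o') * cnj (z - o') = R"
      unfolding R_def complex_norm_square[symmetric] of_real_eq_iff ..
    finally show ?thesis .
  qed
  define x y w where "x = a - o'" and "y = b - o'" and "w = c - o'"
  have nz: "x \<noteq> 0" "y \<noteq> 0" "w \<noteq> 0"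
    using a b c R0 unfolding sph x_def y_def w_def by auto
  have cj: "cnj x = R / x" "cnj y = R / y" "cnj w = R / w"
    using a b c nz unfolding sph x_def y_def w_def by (auto simp: field_simps)
  have df: "x \<noteq> y" "y \<noteq> w" "x \<noteq> w" "a - b = x - y" "b - c = y - w"
    using ne by (auto simp: x_def y_def w_def)
  \<comment> \<open>Conjugation multiplies the part without \<open>d\<close> by
    \<open>w / x\<close>, so this part cancels from the reality condition.\<close>
  have ratio: "cnj ((x - y) / (y - w)) = (x - y) / (y - w) * (w / x)"
    using nz df R0 by (simp add: cj field_simps)
  show ?thesis
  proof (cases d)
    case None
    have "cross_ratio (Some a) (Some b) (Some c) d = - ((x - y) / (y - w))"
      using None df by (simp add: cross_ratio_def minus_divide_left)
    then have "cross_ratio (Some a) (Some b) (Some c) d \<in> \<real> \<longleftrightarrow>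
        (x - y) / (y - w) * (w / x) = (x - y) / (y - w)"
      by (simp only: Reals_cnj_iff ratio complex_cnj_minus neg_equal_iff_equal)
    also have "\<dots> \<longleftrightarrow> w / x = 1"
      using df by (simp only: mult_cancel_left2 divide_eq_0_iff right_minus_eq simp_thms)
    also have "\<dots> \<longleftrightarrow> False"
      using nz df by simp
    finally show ?thesis using None by auto
  next
    case (Some e)
    define v where "v = e - o'"
    have v: "c - e = w - v" "e - a = v - x" "v \<noteq> x"
      using ne Some by (auto simp: w_def v_def x_def)
    have v': "R / x \<noteq> cnj v"
      using v(3) cj(1) by (metis complex_cnj_cancel_iff)
    have "cross_ratio (Some a) (Some b) (Some c) d = (x - y) / (y - w) * ((w - v) / (v - x))"
      using Some df v by (simp add: cross_ratio_def)
    then have "cross_ratio (Some a) (Some b) (Some c) d \<in> \<real> \<longleftrightarrow>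
        (x - y) / (y - w) * (w / x) * ((R / w - cnj v) / (cnj v - R / x)) =
        (x - y) / (y - w) * ((w - v) / (v - x))"
      by (simp only: Reals_cnj_iff ratio complex_cnj_mult[of "(x - y) / (y - w)"])
        (simp add: cj)
    also have "\<dots> \<longleftrightarrow> (w / x) * ((R / w - cnj v) / (cnj v - R / x)) = (w - v) / (v - x)"
      using df by (simp only: mult.assoc mult_cancel_left divide_eq_0_iff right_minus_eq simp_thms)
    also have "(w / x) * ((R / w - cnj v) / (cnj v - R / x)) = (R - w * cnj v) / (x * cnj v - R)"
      using nz v' by (simp add: divide_simps) (simp add: algebra_simps)
    also have "(R - w * cnj v) / (x * cnj v - R) = (w - v) / (v - x) \<longleftrightarrow>
        (R - w * cnj v) * (v - x) = (w - v) * (x * cnj v - R)"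
    proof -
      have "x * cnj v - R \<noteq> 0" using v' nz by (auto simp: field_simps)
      then show ?thesis using v by (simp add: frac_eq_eq)
    qed
    \<comment> \<open>The mixed terms cancel; as \<open>w \<noteq> x\<close>, what remains is the
      circle equation for \<open>v\<close>.\<close>
    also have "\<dots> \<longleftrightarrow> (w - x) * (v * cnj v - R) = 0"
      by (simp add: algebra_simps) (metis add.commute)
    also have "\<dots> \<longleftrightarrow> e \<in> sphere o' r"
      unfolding sph v_def using df by simp
    finally show ?thesis using Some by auto
  qed
qed

text \<open>An affine parameter carries \<open>K\<close> to the extended real line and preserves
  cross-ratios. There, for fixed \<open>a\<close>, \<open>b\<close>, \<open>c\<close>, the
  cross-ratio is an invertible real Moebius function of \<open>d\<close>, so among finite
  \<open>d\<close> it is real only at real ones.\<close>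

lemma cross_ratio_line_iff:
  fixes a b c d :: mpoint and o' o'' :: complex
  defines "K \<equiv> insert None (Some ` (affine hull {o', o''}))"
  assumes "o' \<noteq> o''" and "a \<in> K" "b \<in> K" "c \<in> K"
    and ne: "a \<noteq> b" "b \<noteq> c" "a \<noteq> c" "d \<noteq> a"
  shows "cross_ratio a b c d \<in> \<real> \<longleftrightarrow> d \<in> K"
proof -
  define u where "u = o'' - o'"
  have u: "u \<noteq> 0" using assms(2) by (simp add: u_def)
  define T where "T = map_option (\<lambda>s. o' + s * u)"
  have hull: "z \<in> affine hull {o', o''} \<longleftrightarrow> (\<exists>t. z = o' + complex_of_real t * u)" for z
    by (auto simp: affine_hull_2_alt u_def scaleR_conv_of_real)
  have K: "p \<in> K \<longleftrightarrow> (\<exists>q. p = T (map_option complex_of_real q))" for p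
  proof
    assume "p \<in> K"
    then consider "p = None" | t where "p = Some (o' + complex_of_real t * u)"
      unfolding K_def hull[abs_def] image_iff insert_iff Bex_def by blast
    then show "\<exists>q. p = T (map_option complex_of_real q)"
    proof cases
      case 1
      then show ?thesis by (intro exI[of _ None]) (simp add: T_def)
    next
      case (2 t)
      then show ?thesis by (intro exI[of _ "Some t"]) (simp add: T_def)
    qed
  next
    assume "\<exists>q. p = T (map_option complex_of_real q)"
    then obtain q where q: "p = T (map_option complex_of_real q)" ..
    show "p \<in> K"
      unfolding q K_def T_def by (cases q) (auto simp: hull)
  qed
  have KT: "T p \<in> K \<longleftrightarrow> (p = None \<or> (\<exists>t\<in>\<real>. p = Some t))" for p
    unfolding K_def T_def using u by (cases p) (auto simp: hull image_iff Reals_def)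
  have surj: "\<exists>q. p = T q" for p
  proof (cases p)
    case (Some z)
    then have "p = T (Some ((z - o') / u))" using u by (simp add: T_def)
    then show ?thesis ..
  qed (simp add: T_def)
  obtain a' b' c' d' where
    abc: "a = T (map_option of_real a')" "b = T (map_option of_real b')"
      "c = T (map_option of_real c')" "d = T d'"
    using assms(3-5) surj[of d] unfolding K by blast
  \<comment> \<open>Brackets scale under \<open>T\<close> by one weight per point. Each point occurs
    once above and once below in a cross-ratio, so the weights cancel.\<close>
  define \<sigma> where "\<sigma> p = (case p of None \<Rightarrow> inverse (csqrt u) | Some _ \<Rightarrow> csqrt u)" for p :: mpoint
  have "\<sigma> p \<noteq> 0" for p
    using u by (simp add: \<sigma>_def split: option.split)
  moreover have "bracket (T p) (T q) = bracket p q * \<sigma> p * \<sigma> q" for p q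
    using u by (cases p; cases q)
      (simp_all add: T_def \<sigma>_def left_diff_distrib mult.assoc flip: power2_eq_square)
  ultimately have cr: "cross_ratio (T p) (T q) (T s) (T t) = cross_ratio p q s t" for p q s t
    by (simp add: cross_ratio_def)
  \<comment> \<open>Real homogeneous coordinates \<open>(h1, h2)\<close> treat finite and infinite
    \<open>a\<close>, \<open>b\<close>, \<open>c\<close> alike; only \<open>d\<close> needs a case
    split.\<close>
  define h1 h2 where "h1 = case_option 1 (\<lambda>t::real. t)" and "h2 = case_option 0 (\<lambda>t::real. 1::real)"
  have br: "bracket (map_option of_real p) (map_option of_real q) =
      complex_of_real (h1 p * h2 q - h2 p * h1 q)"
    "bracket (map_option of_real p) (Some s) = of_real (h1 p) - of_real (h2 p) * s" for p q s
    by (cases p; cases q; simp add: h1_def h2_def)+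
  have ne': "bracket (map_option of_real a') (map_option of_real b') \<noteq> 0"
    "bracket (map_option of_real b') (map_option of_real c') \<noteq> 0"
    "bracket (map_option of_real c') (map_option of_real a') \<noteq> 0"
    "d' \<noteq> map_option of_real a'"
    using ne unfolding abc by auto
  show ?thesis
  proof (cases d')
    case None
    then show ?thesis using ne
      unfolding abc cr KT
      by (cases a'; cases b'; cases c') (auto simp: cross_ratio_def)
  next
    case (Some s)
    \<comment> \<open>These are the coefficients of the Moebius function of \<open>s\<close>; its
      determinant \<open>m * l - n * k\<close> is the bracket of \<open>c'\<close> and
      \<open>a'\<close>. The real factor \<open>\<kappa>\<close> collects the brackets free of
      \<open>s\<close>.\<close>
    define m n k l where "m = complex_of_real (h1 c')" and "n = complex_of_real (h2 c')"
      and "k = complex_of_real (h1 a')" and "l = complex_of_real (h2 a')"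
    define \<kappa> where "\<kappa> = - ((h1 a' * h2 b' - h2 a' * h1 b') / (h1 b' * h2 c' - h2 b' * h1 c'))"
    have \<kappa>: "\<kappa> \<noteq> 0"
      using ne'(1,2) unfolding br of_real_eq_0_iff \<kappa>_def by simp
    have det: "m * l - n * k \<noteq> 0"
      using ne'(3) unfolding br m_def n_def k_def l_def by simp
    have nz: "k - l * s \<noteq> 0"
      using ne'(4) unfolding Some k_def l_def br(2)[symmetric] by auto
    have nz': "k - l * cnj s \<noteq> 0"
    proof -
      have "k - l * cnj s = cnj (k - l * s)" by (simp add: k_def l_def)
      then show ?thesis using nz by (simp only: complex_cnj_zero_iff not_False_eq_True)
    qed
    have "cross_ratio (map_option of_real a') (map_option of_real b') (map_option of_real c') (Some s)
        = of_real \<kappa> * ((m - n * s) / (k - l * s))"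
    proof -
      define z where "z = k - l * s"
      have "bracket (Some s) (map_option of_real a') = - z"
        unfolding z_def k_def l_def bracket_commute[of "Some s"] br ..
      then show ?thesis
        unfolding cross_ratio_def z_def[symmetric] by (simp add: br \<kappa>_def m_def n_def)
    qed
    then have "cross_ratio a b c d \<in> \<real> \<longleftrightarrow> (m - n * s) / (k - l * s) \<in> \<real>"
      unfolding abc cr Some using \<kappa> by (simp add: complex_is_Real_iff flip: times_divide_eq_right)
    also have "\<dots> \<longleftrightarrow> (m - n * cnj s) / (k - l * cnj s) = (m - n * s) / (k - l * s)"
      unfolding Reals_cnj_iff by (simp add: m_def n_def k_def l_def)
    also have "\<dots> \<longleftrightarrow> (m * l - n * k) * (cnj s - s) = 0"
      unfolding frac_eq_eq[OF nz' nz] by (simp add: algebra_simps)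
    also have "\<dots> \<longleftrightarrow> d \<in> K"
      using det unfolding abc Some KT by (auto simp: Reals_cnj_iff)
    finally show ?thesis .
  qed
qed

text \<open>The point \<open>d\<close> may coincide with \<open>b\<close> or \<open>c\<close>: the
  cross-ratio is then 1 or 0.\<close>

lemma concyclic_iff_cross_ratio:
  assumes K: "mobius_circle K" and abc: "a \<in> K" "b \<in> K" "c \<in> K"
    and ne: "a \<noteq> b" "b \<noteq> c" "a \<noteq> c" "d \<noteq> a"
  shows "d \<in> K \<longleftrightarrow> cross_ratio a b c d \<in> \<real>"
  using K unfolding mobius_circle_def
proof (elim disjE exE conjE)
  fix o' r assume r: "r > 0" and "K = Some ` sphere o' r"
  then obtain a' b' c' where "a = Some a'" "b = Some b'" "c = Some c'"
    "a' \<in> sphere o' r" "b' \<in> sphere o' r" "c' \<in> sphere o' r"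
    using abc by blast
  then show ?thesis
    using cross_ratio_sphere_iff[OF r, of a' o' b' c' d] ne \<open>K = _\<close> by simp
next
  fix o' o'' assume o: "o' \<noteq> o''" and "K = insert None (Some ` (affine hull {o', o''}))"
  then show ?thesis
    using cross_ratio_line_iff[OF o, of a b c d] abc ne by simp
qed

section \<open>The incidence theorem on the rhombic dodecahedron\<close>

text \<open>The vertices of degree four are \<open>p1\<close>, \<open>p3\<close>, \<open>p5\<close>,
  each joined to \<open>x\<close>, and \<open>q2\<close>, \<open>q4\<close>, \<open>q6\<close>, each
  joined to \<open>y\<close>. The hypotheses make every edge bracket nonzero.\<close>

lemma prod_cross_ratio_rhombic_dodecahedron:
  assumes "distinct [p1, p2, p3, p4, p5, p6, q1, q2, q3, q4, q5, q6]"
    and "x \<notin> {p1, p3, p5}" "y \<notin> {q2, q4, q6}"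
  shows "cross_ratio q6 q1 p1 p6 * cross_ratio p1 q1 q2 p2 * cross_ratio q2 q3 p3 p2
    * cross_ratio p3 q3 q4 p4 * cross_ratio q4 q5 p5 p4 * cross_ratio p5 q5 q6 p6
    * cross_ratio p1 p2 p3 x * cross_ratio p3 p4 p5 x * cross_ratio p5 p6 p1 x
    * cross_ratio q4 q3 q2 y * cross_ratio q6 q5 q4 y * cross_ratio q2 q1 q6 y = 1"
proof -
  \<comment> \<open>One rewrite for each of the 24 edges fixes its direction. Numerator and
    denominator then have the same factors, and the even number of signs cancels.\<close>
  note sw = bracket_commute[of p1 q1] bracket_commute[of p2 q2] bracket_commute[of p3 q3]
    bracket_commute[of p4 q4] bracket_commute[of p5 q5] bracket_commute[of p6 q6]
    bracket_commute[of p1 p2] bracket_commute[of p2 p3] bracket_commute[of p3 p4]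
    bracket_commute[of p4 p5] bracket_commute[of p5 p6] bracket_commute[of p6 p1]
    bracket_commute[of q1 q2] bracket_commute[of q2 q3] bracket_commute[of q3 q4]
    bracket_commute[of q4 q5] bracket_commute[of q5 q6] bracket_commute[of q6 q1]
    bracket_commute[of p1 x] bracket_commute[of p3 x] bracket_commute[of p5 x]
    bracket_commute[of q2 y] bracket_commute[of q4 y] bracket_commute[of q6 y]
  show ?thesis
    unfolding sw cross_ratio_def times_divide_times_eq divide_eq_1_iff
    by (rule conjI, (use assms in auto)[1])
      (simp only: mult_minus_left mult_minus_right minus_minus mult_ac)
qed

text \<open>One implication, with free vertex names so that relabelling also yields the converse.
  The closing face puts \<open>y\<close>, the second common point of \<open>D1\<close> and
  \<open>D2\<close>, on \<open>D3\<close>.\<close>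

lemma rhombic_dodecahedron_closing:
  assumes black: "mobius_circle C1" "mobius_circle C2" "mobius_circle C3"
      "mobius_circle C4" "mobius_circle C5" "mobius_circle C6"
    and black_through: "{q6, q1, p1, p6} \<subseteq> C1" "{p1, q1, q2, p2} \<subseteq> C2"
      "{q2, q3, p3, p2} \<subseteq> C3" "{p3, q3, q4, p4} \<subseteq> C4"
      "{q4, q5, p5, p4} \<subseteq> C5" "{p5, q5, q6, p6} \<subseteq> C6"
    and grey: "mobius_circle G1" "mobius_circle G2" "mobius_circle G3"
    and grey_through: "{p1, p2, p3} \<subseteq> G1" "{p3, p4, p5} \<subseteq> G2" "{p5, p6, p1} \<subseteq> G3"
    and dashed: "mobius_circle D1" "mobius_circle D2" "mobius_circle D3"
    and dashed_through: "{q2, q3, q4} \<subseteq> D1" "{q4, q5, q6} \<subseteq> D2" "{q6, q1, q2} \<subseteq> D3"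
    and dist: "distinct [p1, p2, p3, p4, p5, p6, q1, q2, q3, q4, q5, q6]"
    and grey_second: "G1 \<inter> G2 = {p3, x}"
    and grey_adjacent: "p3 \<notin> G1 \<inter> G3"
    and x: "x \<notin> {p1, p3, p5}"
    and dashed_second: "D1 \<inter> D2 = {q4, y}" and y: "y \<notin> {q2, q4, q6}"
    and conc: "concurrent G1 G2 G3"
  shows "concurrent D1 D2 D3"
proof -
  \<comment> \<open>The common point given by \<open>conc\<close> lies in \<open>{p3, x}\<close>,
    and \<open>grey_adjacent\<close> excludes \<open>p3\<close>.\<close>
  have xG: "x \<in> G1" "x \<in> G2" "x \<in> G3"
  proof -
    obtain z where "z \<in> G1" "z \<in> G2" "z \<in> G3"
      using conc unfolding concurrent_def by blast
    moreover from this have "z \<in> {p3, x}" "z \<noteq> p3"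
      unfolding grey_second[symmetric] using grey_adjacent by auto
    ultimately show "x \<in> G1" "x \<in> G2" "x \<in> G3" by auto
  qed
  have yD: "y \<in> D1" "y \<in> D2"
    using dashed_second by blast+
  have real: "cross_ratio a b c d \<in> \<real>"
    if "mobius_circle K" "{a, b, c, d} \<subseteq> K" "distinct [a, b, c]" "d \<noteq> a" for a b c d K
    using concyclic_iff_cross_ratio[of K a b c d] that by auto
  \<comment> \<open>Only the face on \<open>D3\<close>, not yet known to be concyclic, is omitted;
    its cross-ratio will be the inverse of the real number \<open>t\<close>.\<close>
  define t where "t = cross_ratio q6 q1 p1 p6 * cross_ratio p1 q1 q2 p2 * cross_ratio q2 q3 p3 p2
    * cross_ratio p3 q3 q4 p4 * cross_ratio q4 q5 p5 p4 * cross_ratio p5 q5 q6 p6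
    * cross_ratio p1 p2 p3 x * cross_ratio p3 p4 p5 x * cross_ratio p5 p6 p1 x
    * cross_ratio q4 q3 q2 y * cross_ratio q6 q5 q4 y"
  have faces: "{p1, p2, p3, x} \<subseteq> G1" "{p3, p4, p5, x} \<subseteq> G2" "{p5, p6, p1, x} \<subseteq> G3"
    "{q4, q3, q2, y} \<subseteq> D1" "{q6, q5, q4, y} \<subseteq> D2"
    using grey_through dashed_through xG yD by simp_all
  have "t \<in> \<real>"
    unfolding t_def
    by (intro Reals_mult
        real[OF black(1) black_through(1)] real[OF black(2) black_through(2)]
        real[OF black(3) black_through(3)] real[OF black(4) black_through(4)]
        real[OF black(5) black_through(5)] real[OF black(6) black_through(6)]
        real[OF grey(1) faces(1)] real[OF grey(2) faces(2)] real[OF grey(3) faces(3)]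
        real[OF dashed(1) faces(4)] real[OF dashed(2) faces(5)])
      (use dist x y in auto)
  moreover have "t * cross_ratio q2 q1 q6 y = 1"
    unfolding t_def by (rule prod_cross_ratio_rhombic_dodecahedron[OF dist x y])
  ultimately have "cross_ratio q2 q1 q6 y \<in> \<real>"
    by (metis Reals_inverse inverse_unique)
  then have "y \<in> D3"
    using concyclic_iff_cross_ratio[OF dashed(3), of q2 q1 q6 y] dashed_through(3) dist y by auto
  then show ?thesis
    using yD unfolding concurrent_def by blast
qed

theorem theorem5p3:
  fixes C :: "nat \<Rightarrow> mpoint set"
    and P Q :: "nat \<Rightarrow> mpoint"
    and G1 G2 G3 D1 D2 D3 :: "mpoint set"
  assumes black: "\<And>i. i \<in> {1..6} \<Longrightarrow> mobius_circle (C i)"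
    and black_meet: "\<And>i. i \<in> {1..6} \<Longrightarrow> C i \<inter> C (i mod 6 + 1) = {P i, Q i}"
    and grey: "mobius_circle G1" "mobius_circle G2" "mobius_circle G3"
    and grey_through: "{P 1, P 2, P 3} \<subseteq> G1" "{P 3, P 4, P 5} \<subseteq> G2" "{P 5, P 6, P 1} \<subseteq> G3"
    and dashed: "mobius_circle D1" "mobius_circle D2" "mobius_circle D3"
    and dashed_through: "{Q 2, Q 3, Q 4} \<subseteq> D1" "{Q 4, Q 5, Q 6} \<subseteq> D2" "{Q 6, Q 1, Q 2} \<subseteq> D3"
    and distinct_points:
      "distinct [P 1, P 2, P 3, P 4, P 5, P 6, Q 1, Q 2, Q 3, Q 4, Q 5, Q 6]"
    and distinct_circles:
      "distinct [C 1, C 2, C 3, C 4, C 5, C 6, G1, G2, G3, D1, D2, D3]"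
    and grey_second:
      "\<exists>X. G1 \<inter> G2 = {P 3, X} \<and> X \<notin> P ` {1..6} \<union> Q ` {1..6}"
      "\<exists>X. G2 \<inter> G3 = {P 5, X} \<and> X \<notin> P ` {1..6} \<union> Q ` {1..6}"
      "\<exists>X. G3 \<inter> G1 = {P 1, X} \<and> X \<notin> P ` {1..6} \<union> Q ` {1..6}"
    and dashed_second:
      "\<exists>X. D1 \<inter> D2 = {Q 4, X} \<and> X \<notin> P ` {1..6} \<union> Q ` {1..6}"
      "\<exists>X. D2 \<inter> D3 = {Q 6, X} \<and> X \<notin> P ` {1..6} \<union> Q ` {1..6}"
      "\<exists>X. D3 \<inter> D1 = {Q 2, X} \<and> X \<notin> P ` {1..6} \<union> Q ` {1..6}"
  shows "concurrent G1 G2 G3 \<longleftrightarrow> concurrent D1 D2 D3"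
proof -
  have "C 1 \<inter> C 2 = {P 1, Q 1}" "C 2 \<inter> C 3 = {P 2, Q 2}" "C 3 \<inter> C 4 = {P 3, Q 3}"
    "C 4 \<inter> C 5 = {P 4, Q 4}" "C 5 \<inter> C 6 = {P 5, Q 5}" "C 6 \<inter> C 1 = {P 6, Q 6}"
    using black_meet[of 1] black_meet[of 2] black_meet[of 3] black_meet[of 4]
      black_meet[of 5] black_meet[of 6] by (simp_all del: One_nat_def)
  \<comment> \<open>With indices from 1 to 6, \<open>C i\<close> carries the pairs numbered
    \<open>i - 1\<close> and \<open>i\<close>, and \<open>C 1\<close> those numbered 6 and
    1.\<close>
  then have through:
    "{P 6, Q 6, P 1, Q 1} \<subseteq> C 1" "{P 1, Q 1, P 2, Q 2} \<subseteq> C 2" "{P 2, Q 2, P 3, Q 3} \<subseteq> C 3"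
    "{P 3, Q 3, P 4, Q 4} \<subseteq> C 4" "{P 4, Q 4, P 5, Q 5} \<subseteq> C 5" "{P 5, Q 5, P 6, Q 6} \<subseteq> C 6"
    by blast+
  have circ: "mobius_circle (C 1)" "mobius_circle (C 2)" "mobius_circle (C 3)"
    "mobius_circle (C 4)" "mobius_circle (C 5)" "mobius_circle (C 6)"
    using black by simp_all
  let ?V = "P ` {1..6} \<union> Q ` {1..6}"
  have V: "P i \<in> ?V" "Q i \<in> ?V" if "i \<in> {1..6}" for i
    using that by blast+
  obtain X1 X2 X3 where X: "G1 \<inter> G2 = {P 3, X1}" "G2 \<inter> G3 = {P 5, X2}" "G3 \<inter> G1 = {P 1, X3}"
    "X1 \<notin> ?V" "X2 \<notin> ?V" "X3 \<notin> ?V"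
    using grey_second by blast
  obtain Y1 Y2 Y3 where Y: "D1 \<inter> D2 = {Q 4, Y1}" "D2 \<inter> D3 = {Q 6, Y2}" "D3 \<inter> D1 = {Q 2, Y3}"
    "Y1 \<notin> ?V" "Y2 \<notin> ?V" "Y3 \<notin> ?V"
    using dashed_second by blast
  have not_X: "X1 \<notin> {P 1, P 3, P 5}" "X2 \<notin> {P 1, P 3, P 5}"
    using X V by auto
  have not_Y: "Y1 \<notin> {Q 2, Q 4, Q 6}"
    using Y V by auto
  \<comment> \<open>General position keeps the grey circles from concurring at the labelled point
    \<open>P 3\<close>, which would have to be \<open>P 1\<close> or \<open>X3\<close>.\<close>
  have P3: "P 3 \<notin> G1 \<inter> G3"
  proof -
    have "P 3 \<noteq> P 1" "P 3 \<noteq> X3" using distinct_points X(6) V(1)[of 3] by auto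
    then show ?thesis using X(3) by blast
  qed
  have Q4: "Q 4 \<notin> D1 \<inter> D3"
  proof -
    have "Q 4 \<noteq> Q 2" "Q 4 \<noteq> Y3" using distinct_points Y(6) V(2)[of 4] by auto
    then show ?thesis using Y(3) by blast
  qed
  show ?thesis
  proof
    assume "concurrent G1 G2 G3"
    then show "concurrent D1 D2 D3"
      by (intro rhombic_dodecahedron_closing[OF circ _ _ _ _ _ _ grey grey_through
            dashed dashed_through distinct_points X(1) P3 not_X(1) Y(1) not_Y])
        (use through in auto)
  next
    assume "concurrent D1 D2 D3"
    moreover have "{P 1, P 2, Q 2, Q 1} \<subseteq> C 2" "{Q 2, P 2, P 3, Q 3} \<subseteq> C 3"
      "{P 3, P 4, Q 4, Q 3} \<subseteq> C 4" "{Q 4, P 4, P 5, Q 5} \<subseteq> C 5"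
      "{P 5, P 6, Q 6, Q 5} \<subseteq> C 6" "{Q 6, P 6, P 1, Q 1} \<subseteq> C 1"
      using through by simp_all
    moreover have "distinct [Q 2, Q 3, Q 4, Q 5, Q 6, Q 1, P 2, P 3, P 4, P 5, P 6, P 1]"
      using distinct_points by auto
    moreover have "X2 \<notin> {P 3, P 5, P 1}"
      using not_X(2) by simp
    \<comment> \<open>The configuration is invariant under the index shift \<open>i \<mapsto> i + 1\<close> with \<open>P\<close> and \<open>Q\<close> exchanged.\<close>
    ultimately have "concurrent G2 G3 G1"
      by (intro rhombic_dodecahedron_closing[OF circ(2-6) circ(1) _ _ _ _ _ _ dashed
            dashed_through grey(2,3,1) grey_through(2,3,1) _ Y(1) Q4 not_Y X(2)])
    then show "concurrent G1 G2 G3"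
      unfolding concurrent_def by blast
  qed
qed

end
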